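(* Let $p$ be an odd prime. Every finitely generated pro-$p$ group of small powerful class is a PF-group.
   Context: Finite generation of a pro-$p$ group is in the topological sense. For a closed subgroup $N$ of a pro-$p$ group, $N^p$ denotes the closure of the subgroup generated by all $p$-th powers of elements of $N$; commutator subgroups are taken to be closed, and $[N,{}_{j}G]=[N,G,\ldots,G]$ with $j$ copies of $G$ (left-normed). Let $p$ be odd. A closed normal subgroup $N$ of a pro-$p$ group $G$ is powerfully embedded in $G$ if $[N,G]\le N^p$. An $\eta$-series of $G$ is an ascending series $1=N_0\le N_1\le N_2\le\cdots$ of closed normal subgroups of $G$ such that $N_{i+1}/N_i$ is powerfully embedded in $G/N_i$ for all $i$. The powerful class $\mathrm{pwc}(G)$ is the smallest $k$ such that $G$ has an $\eta$-series with $N_k=G$ (if such $k$ exists). $G$ has small powerful class if $\mathrm{pwc}(G)<p$ (in particular it is finite). A closed normal subgroup $N$ of a pro-$p$ group $G$ is PF-embedded in $G$ if there is a series $N=N_1\ge N_2\ge\cdots$ of closed normal subgroups of $G$ with $\bigcap_{i}N_i=1$, $[N_i,G]\le N_{i+1}$ and $[N_i,{}_{p-1}G]\le N_{i+1}^p$ for all $i\ge 1$ (a potent filtration of $N$ in $G$). $G$ is a PF-group if it is PF-embedded in itself. *)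

theory Defs
  imports
    "HOL-Analysis.Product_Topology"
    "HOL-Analysis.T1_Spaces"
    "HOL-Algebra.Generated_Groups"
    "HOL-Computational_Algebra.Primes"
    "HOL-Library.Extended_Nat"
begin

locale topological_group = group G for G (structure) and T :: "'a topology" +
  assumes topspace_eq: "topspace T = carrier G"
    and continuous_mult: "continuous_map (prod_topology T T) T (\<lambda>(x, y). x \<otimes> y)"
    and continuous_inv: "continuous_map T T (\<lambda>x. inv x)"

locale profinite_group = topological_group +
  assumes compact: "compact_space T"
    and Hausdorff: "Hausdorff_space T"
    and open_subgroup_base:
      "\<And>U. openin T U \<Longrightarrow> \<one> \<in> U \<Longrightarrow> \<exists>H. subgroup H G \<and> openin T H \<and> H \<subseteq> U"

text \<open>
  The index of an open normal subgroup is automatically finite by compactness, so that the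
  convention \<^term>\<open>card A = 0\<close> for infinite \<open>A\<close> plays no role here.
\<close>

locale pro_p_group = profinite_group G T for p :: nat and G (structure) and T +
  assumes index_power: "\<And>N. N \<lhd> G \<Longrightarrow> openin T N \<Longrightarrow> \<exists>k. card (rcosets N) = p ^ k"

definition generate_closed ::
    "('a, 'b) monoid_scheme \<Rightarrow> 'a topology \<Rightarrow> 'a set \<Rightarrow> 'a set" where
  "generate_closed G T S = T closure_of (generate G S)"

definition topologically_finitely_generated ::
    "('a, 'b) monoid_scheme \<Rightarrow> 'a topology \<Rightarrow> bool" where
  "topologically_finitely_generated G T \<longleftrightarrow>
     (\<exists>S. finite S \<and> S \<subseteq> carrier G \<and> generate_closed G T S = carrier G)"

definition closed_normal ::
    "('a, 'b) monoid_scheme \<Rightarrow> 'a topology \<Rightarrow> 'a set \<Rightarrow> bool" where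
  "closed_normal G T N \<longleftrightarrow> N \<lhd> G \<and> closedin T N"

definition closed_powers ::
    "nat \<Rightarrow> ('a, 'b) monoid_scheme \<Rightarrow> 'a topology \<Rightarrow> 'a set \<Rightarrow> 'a set" where
  "closed_powers p G T N = generate_closed G T {x [^]\<^bsub>G\<^esub> p |x. x \<in> N}"

definition closed_commutator ::
    "('a, 'b) monoid_scheme \<Rightarrow> 'a topology \<Rightarrow> 'a set \<Rightarrow> 'a set \<Rightarrow> 'a set" where
  "closed_commutator G T H K = generate_closed G T
     {inv\<^bsub>G\<^esub> h \<otimes>\<^bsub>G\<^esub> inv\<^bsub>G\<^esub> k \<otimes>\<^bsub>G\<^esub> h \<otimes>\<^bsub>G\<^esub> k |h k. h \<in> H \<and> k \<in> K}"

text \<open>The left-normed commutator \<open>[N, G, \<dots>, G]\<close> with \<open>j\<close> copies of \<open>G\<close>.\<close>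

definition iterated_commutator ::
    "('a, 'b) monoid_scheme \<Rightarrow> 'a topology \<Rightarrow> nat \<Rightarrow> 'a set \<Rightarrow> 'a set" where
  "iterated_commutator G T j N = ((\<lambda>M. closed_commutator G T M (carrier G)) ^^ j) N"

text \<open>This is the notion for odd \<open>p\<close>; for \<open>p = 2\<close> one would use fourth powers instead.\<close>

definition powerfully_embedded ::
    "nat \<Rightarrow> ('a, 'b) monoid_scheme \<Rightarrow> 'a topology \<Rightarrow> 'a set \<Rightarrow> bool" where
  "powerfully_embedded p G T N \<longleftrightarrow>
     closed_normal G T N \<and> closed_commutator G T N (carrier G) \<subseteq> closed_powers p G T N"

definition quotient_topology :: "'a topology \<Rightarrow> ('a \<Rightarrow> 'b) \<Rightarrow> 'b topology" where
  "quotient_topology X q =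
     topology (\<lambda>U. U \<subseteq> q ` topspace X \<and> openin X {x \<in> topspace X. q x \<in> U})"

lemma openin_quotient_topology:
  "openin (quotient_topology X q) U \<longleftrightarrow>
     U \<subseteq> q ` topspace X \<and> openin X {x \<in> topspace X. q x \<in> U}"
proof -
  have "istopology (\<lambda>U. U \<subseteq> q ` topspace X \<and> openin X {x \<in> topspace X. q x \<in> U})"
    unfolding istopology_def
  proof (intro conjI allI impI)
    fix S S' assume "S \<subseteq> q ` topspace X \<and> openin X {x \<in> topspace X. q x \<in> S}"
      and "S' \<subseteq> q ` topspace X \<and> openin X {x \<in> topspace X. q x \<in> S'}"
    moreover have "{x \<in> topspace X. q x \<in> S \<inter> S'} =
        {x \<in> topspace X. q x \<in> S} \<inter> {x \<in> topspace X. q x \<in> S'}"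
      by blast
    ultimately show "S \<inter> S' \<subseteq> q ` topspace X" "openin X {x \<in> topspace X. q x \<in> S \<inter> S'}"
      by auto
  next
    fix \<K> assume *: "\<forall>K\<in>\<K>. K \<subseteq> q ` topspace X \<and> openin X {x \<in> topspace X. q x \<in> K}"
    then show "\<Union>\<K> \<subseteq> q ` topspace X" by blast
    have "{x \<in> topspace X. q x \<in> \<Union>\<K>} = (\<Union>K\<in>\<K>. {x \<in> topspace X. q x \<in> K})"
      by blast
    then show "openin X {x \<in> topspace X. q x \<in> \<Union>\<K>}"
      using * by auto
  qed
  then show ?thesis
    by (simp add: quotient_topology_def)
qed

lemma topspace_quotient_topology: "topspace (quotient_topology X q) = q ` topspace X"
proof -
  have "{x \<in> topspace X. q x \<in> q ` topspace X} = topspace X" by blast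
  then have "openin (quotient_topology X q) (q ` topspace X)"
    by (simp add: openin_quotient_topology)
  then show ?thesis
    by (metis openin_quotient_topology openin_subset openin_topspace subset_antisym)
qed

lemma quotient_map_quotient_topology: "quotient_map X (quotient_topology X q) q"
  by (auto simp: quotient_map_def topspace_quotient_topology openin_quotient_topology)

definition Mod_topology ::
    "('a, 'b) monoid_scheme \<Rightarrow> 'a topology \<Rightarrow> 'a set \<Rightarrow> 'a set topology" where
  "Mod_topology G T N = quotient_topology T (\<lambda>x. N #>\<^bsub>G\<^esub> x)"

definition eta_series ::
    "nat \<Rightarrow> ('a, 'b) monoid_scheme \<Rightarrow> 'a topology \<Rightarrow> (nat \<Rightarrow> 'a set) \<Rightarrow> bool" where
  "eta_series p G T N \<longleftrightarrow>
     N 0 = {\<one>\<^bsub>G\<^esub>} \<and>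
     (\<forall>i. closed_normal G T (N i)) \<and>
     (\<forall>i. N i \<subseteq> N (Suc i)) \<and>
     (\<forall>i. powerfully_embedded p (G Mod N i) (Mod_topology G T (N i))
            ((\<lambda>x. N i #>\<^bsub>G\<^esub> x) ` N (Suc i)))"

text \<open>The value is \<open>\<infinity>\<close> if no \<open>\<eta>\<close>-series reaches \<open>G\<close>.\<close>

definition powerful_class ::
    "nat \<Rightarrow> ('a, 'b) monoid_scheme \<Rightarrow> 'a topology \<Rightarrow> enat" where
  "powerful_class p G T = Inf {enat k |k. \<exists>N. eta_series p G T N \<and> N k = carrier G}"

definition small_powerful_class ::
    "nat \<Rightarrow> ('a, 'b) monoid_scheme \<Rightarrow> 'a topology \<Rightarrow> bool" where
  "small_powerful_class p G T \<longleftrightarrow> powerful_class p G T < enat p"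

text \<open>Series are indexed from \<open>1\<close>; the value \<open>M 0\<close> is irrelevant.\<close>

definition potent_filtration ::
    "nat \<Rightarrow> ('a, 'b) monoid_scheme \<Rightarrow> 'a topology \<Rightarrow> 'a set \<Rightarrow> (nat \<Rightarrow> 'a set) \<Rightarrow> bool" where
  "potent_filtration p G T N M \<longleftrightarrow>
     M 1 = N \<and>
     (\<forall>i\<ge>1. closed_normal G T (M i)) \<and>
     (\<forall>i\<ge>1. M (Suc i) \<subseteq> M i) \<and>
     (\<Inter>i\<in>{1..}. M i) = {\<one>\<^bsub>G\<^esub>} \<and>
     (\<forall>i\<ge>1. closed_commutator G T (M i) (carrier G) \<subseteq> M (Suc i)) \<and>
     (\<forall>i\<ge>1. iterated_commutator G T (p - 1) (M i) \<subseteq> closed_powers p G T (M (Suc i)))"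

definition PF_embedded ::
    "nat \<Rightarrow> ('a, 'b) monoid_scheme \<Rightarrow> 'a topology \<Rightarrow> 'a set \<Rightarrow> bool" where
  "PF_embedded p G T N \<longleftrightarrow> closed_normal G T N \<and> (\<exists>M. potent_filtration p G T N M)"

definition PF_group :: "nat \<Rightarrow> ('a, 'b) monoid_scheme \<Rightarrow> 'a topology \<Rightarrow> bool" where
  "PF_group p G T \<longleftrightarrow> PF_embedded p G T (carrier G)"

end

theory Submission
  imports
    Defs
    "HOL-Algebra.Group_Action"
    "HOL-Algebra.Multiplicative_Group"
begin

text \<open>
  Let \<open>1 = N 0 \<le> \<dots> \<le> N k = G\<close> be an \<open>\<eta>\<close>-series with \<open>k < p\<close>. Define \<open>L 0 = G\<close> and let
  \<open>L (Suc n)\<close> be the closed subgroup generated by the \<open>p\<close>-th powers of \<open>L n\<close> together with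
  \<open>N (k - Suc n)\<close>. As soon as \<open>Suc n \<ge> k\<close>, the second contribution is trivial, and
  \<open>L (Suc n)\<close> is the subgroup \<open>(L n)\<^sup>p\<close>. This descending series is the required potent filtration.

  Its main property is \<open>[L n, G] \<le> L (Suc n)\<close> (lemma \<open>L_central_mod\<close>). It implies that
  commuting \<open>p - 1\<close> times with \<open>G\<close> leads from \<open>L n\<close> into \<open>L (n + p - 1)\<close>. Since \<open>k \<le> p - 1\<close>, this
  term equals \<open>(L (n + p - 2))\<^sup>p\<close>, and since \<open>p \<ge> 3\<close> it is contained in \<open>(L (Suc n))\<^sup>p\<close>, as a
  potent filtration demands.

  The main property is proved by induction on \<open>n\<close>. For the generators taken from the
  \<open>\<eta>\<close>-series it holds because \<open>[N (Suc i), G] \<le> N (Suc i)\<^sup>p N i\<close>. For a generator \<open>x\<^sup>p\<close> with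
  \<open>x \<in> L n\<close>, the induction hypothesis puts \<open>c = [x, g]\<close> into \<open>L (Suc n)\<close>. If \<open>t = [c, x]\<close> were
  central modulo \<open>L (n + 2)\<close>, the class two formula would give \<open>[x\<^sup>p, g] = c\<^sup>p t\<^bsup>p(p-1)/2\<^esup>\<close>
  there, and both factors are trivial modulo \<open>L (n + 2)\<close> because \<open>c\<close> and \<open>t\<close> lie in \<open>L (Suc n)\<close> and
  \<open>p\<close> is odd. That \<open>t\<close> may be taken to be central is the usual nilpotency argument. In a finite
  quotient \<open>G / U\<close> one descends from \<open>G\<close> to \<open>U\<close> through subgroups \<open>K\<close>, each of them
  central modulo the next; once \<open>[L (Suc n), G] \<le> L (n + 2) K\<close> is known for one of them, \<open>t\<close> lies in
  \<open>L (n + 2) K\<close> and so is central modulo the product of \<open>L (n + 2)\<close> with the next.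
  The rule \<open>open_normal_induct\<close> packages this descent, and \<open>mem_closed_subgroupI\<close> transfers the
  result from the finite quotients to \<open>G\<close>.

  The subgroups \<open>L n\<close> have trivial intersection because in a finite quotient of \<open>G\<close> repeated
  passage to \<open>p\<close>-th powers reaches the trivial subgroup.
\<close>

section \<open>Commutators and powers in groups\<close>

context group
begin

lemma inv_mult_cancel_left:
  assumes "x \<in> carrier G" "y \<in> carrier G"
  shows "x \<otimes> (inv x \<otimes> y) = y" "inv x \<otimes> (x \<otimes> y) = y"
  using assms by (simp_all flip: m_assoc)

lemmas word_simps = m_assoc inv_mult_group inv_mult_cancel_left

abbreviation commutator :: "'a \<Rightarrow> 'a \<Rightarrow> 'a" where
  "commutator x y \<equiv> inv x \<otimes> inv y \<otimes> x \<otimes> y"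

text \<open>
  Modulo a normal subgroup \<open>X\<close>, this is the preimage of the centre of \<open>G / X\<close>. Hence
  \<open>N \<subseteq> central_mod X\<close> expresses \<open>[N, G] \<le> X\<close> through single commutators, so that no subgroup
  generated by commutators has to be handled.
\<close>

definition central_mod :: "'a set \<Rightarrow> 'a set" where
  "central_mod X = {z \<in> carrier G. \<forall>g\<in>carrier G. commutator z g \<in> X}"

lemma mem_normal_by_conj:
  assumes "X \<lhd> G" "g \<in> carrier G" "z \<in> X"
  shows "inv g \<otimes> z \<otimes> g \<in> X" "g \<otimes> z \<otimes> inv g \<in> X"
  using assms by (simp_all add: normal.inv_op_closed1 normal.inv_op_closed2)

lemma subset_central_mod_normal:
  assumes "X \<lhd> G"
  shows "X \<subseteq> central_mod X"
proof
  fix z assume z: "z \<in> X"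
  interpret normal X G by fact
  show "z \<in> central_mod X"
    unfolding central_mod_def
  proof (intro CollectI conjI ballI)
    show "z \<in> carrier G" using z by simp
    fix g assume g: "g \<in> carrier G"
    have "inv z \<otimes> (inv g \<otimes> z \<otimes> g) \<in> X"
      using z g by (simp add: mem_normal_by_conj[OF assms])
    then show "commutator z g \<in> X" using z g by (simp add: word_simps)
  qed
qed

lemma normal_if_subset_central_mod:
  assumes "subgroup H G" "X \<subseteq> H" "H \<subseteq> central_mod X"
  shows "H \<lhd> G"
proof (rule normal_invI[OF assms(1)])
  interpret subgroup H G by fact
  fix g h assume g: "g \<in> carrier G" and h: "h \<in> H"
  have "commutator h (inv g) \<in> H"
    using g h assms(2,3) unfolding central_mod_def by blast
  then have "h \<otimes> commutator h (inv g) \<in> H" using h by simp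
  then show "g \<otimes> h \<otimes> inv g \<in> H" using g mem_carrier[OF h] by (simp add: word_simps)
qed

lemma subgroup_central_mod:
  assumes "X \<lhd> G"
  shows "subgroup (central_mod X) G"
proof
  interpret normal X G by fact
  show "central_mod X \<subseteq> carrier G" by (auto simp: central_mod_def)
  show "\<one> \<in> central_mod X" by (simp add: central_mod_def)
  show "z \<otimes> w \<in> central_mod X" if "z \<in> central_mod X" "w \<in> central_mod X" for z w
    unfolding central_mod_def
  proof (intro CollectI conjI ballI)
    show "z \<otimes> w \<in> carrier G" using that by (simp add: central_mod_def)
    fix g assume g: "g \<in> carrier G"
    have "(inv w \<otimes> commutator z g \<otimes> w) \<otimes> commutator w g \<in> X"
      using that g mem_normal_by_conj[OF assms] by (simp add: central_mod_def)
    then show "commutator (z \<otimes> w) g \<in> X"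
      using that g by (simp add: central_mod_def word_simps)
  qed
  show "inv z \<in> central_mod X" if "z \<in> central_mod X" for z
    unfolding central_mod_def
  proof (intro CollectI conjI ballI)
    show "inv z \<in> carrier G" using that by (simp add: central_mod_def)
    fix g assume g: "g \<in> carrier G"
    have "z \<otimes> inv (commutator z g) \<otimes> inv z \<in> X"
      using that g mem_normal_by_conj[OF assms] by (simp add: central_mod_def)
    then show "commutator (inv z) g \<in> X"
      using that g by (simp add: central_mod_def word_simps)
  qed
qed

text \<open>
  The collection formula in class two: moving one copy of \<open>x\<close> to the left past \<open>c [^] n\<close> costs
  \<open>t [^] n\<close>, and the costs add up to \<open>0 + 1 + \<dots> + (n - 1)\<close>.
\<close>
lemma pow_mult_class_two:
  fixes n :: nat
  assumes carr: "x \<in> carrier G" "c \<in> carrier G" "t \<in> carrier G"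
    and swap: "c \<otimes> x = x \<otimes> c \<otimes> t"
    and central: "x \<otimes> t = t \<otimes> x" "c \<otimes> t = t \<otimes> c"
  shows "(x \<otimes> c) [^] n = x [^] n \<otimes> c [^] n \<otimes> t [^] (n choose 2)"
proof (induction n)
  case (Suc n)
  have move: "c [^] m \<otimes> x = x \<otimes> c [^] m \<otimes> t [^] m" for m :: nat
  proof (induction m)
    case (Suc m)
    have "c [^] Suc m \<otimes> x = c [^] m \<otimes> (c \<otimes> x)"
      using carr by (simp add: m_assoc)
    also have "\<dots> = (c [^] m \<otimes> x) \<otimes> c \<otimes> t"
      using carr by (simp add: swap m_assoc)
    also have "\<dots> = x \<otimes> c [^] m \<otimes> (t [^] m \<otimes> c) \<otimes> t"
      using carr by (simp add: Suc m_assoc)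
    also have "t [^] m \<otimes> c = c \<otimes> t [^] m"
      using carr central by (simp add: group_commutes_pow)
    finally show ?case using carr by (simp add: m_assoc)
  qed (use carr in simp)
  have cx: "(x \<otimes> c) \<otimes> t = t \<otimes> (x \<otimes> c)"
    using carr central by (metis m_assoc)
  have "(x \<otimes> c) [^] Suc n = x [^] n \<otimes> c [^] n \<otimes> (t [^] (n choose 2) \<otimes> (x \<otimes> c))"
    using carr by (simp add: Suc m_assoc)
  also have "t [^] (n choose 2) \<otimes> (x \<otimes> c) = (x \<otimes> c) \<otimes> t [^] (n choose 2)"
    using carr cx by (simp add: group_commutes_pow)
  also have "x [^] n \<otimes> c [^] n \<otimes> ((x \<otimes> c) \<otimes> t [^] (n choose 2))
      = x [^] n \<otimes> (c [^] n \<otimes> x) \<otimes> c \<otimes> t [^] (n choose 2)"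
    using carr by (simp add: m_assoc)
  also have "\<dots> = x [^] Suc n \<otimes> c [^] n \<otimes> (t [^] n \<otimes> c) \<otimes> t [^] (n choose 2)"
    using carr by (simp add: move m_assoc)
  also have "t [^] n \<otimes> c = c \<otimes> t [^] n"
    using carr central by (simp add: group_commutes_pow)
  also have "x [^] Suc n \<otimes> c [^] n \<otimes> (c \<otimes> t [^] n) \<otimes> t [^] (n choose 2)
      = x [^] Suc n \<otimes> c [^] Suc n \<otimes> t [^] (n + (n choose 2))"
    using carr by (simp add: m_assoc nat_pow_mult)
  also have "n + (n choose 2) = Suc n choose 2"
    by (simp add: numeral_2_eq_2)
  finally show ?case .
qed (simp add: numeral_2_eq_2)

end

lemma (in normal) group_hom_Mod: "group_hom G (G Mod H) (\<lambda>x. H #> x)"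
  using factorgroup_is_group r_coset_hom_Mod
  by (simp add: group_hom_def group_hom_axioms_def is_group)

lemma (in normal) r_coset_eq_one_iff:
  assumes "x \<in> carrier G"
  shows "H #> x = \<one>\<^bsub>G Mod H\<^esub> \<longleftrightarrow> x \<in> H"
  by (metis assms coset_join1 coset_join2 one_FactGroup subgroup_axioms subset)

lemma (in group) conj_pow:
  fixes n :: nat
  assumes "x \<in> carrier G" "g \<in> carrier G"
  shows "inv g \<otimes> x [^] n \<otimes> g = (inv g \<otimes> x \<otimes> g) [^] n"
proof (induction n)
  case (Suc n)
  have "inv g \<otimes> x [^] Suc n \<otimes> g = (inv g \<otimes> x [^] n \<otimes> g) \<otimes> (inv g \<otimes> x \<otimes> g)"
    using assms by (simp add: word_simps)
  then show ?case by (simp add: Suc)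
qed (use assms in simp)

lemma (in group) subgroup_nat_pow_closed:
  fixes n :: nat
  assumes "subgroup H G" "h \<in> H"
  shows "h [^] n \<in> H"
proof (induction n)
  case 0
  show ?case using subgroup.one_closed[OF assms(1)] by simp
next
  case (Suc n)
  then show ?case using subgroup.m_closed[OF assms(1) _ assms(2)] by simp
qed

text \<open>
  With \<open>c = [x, g]\<close> and \<open>t = [c, x]\<close> one has \<open>[x [^] p, g] = inv x [^] p \<otimes> (x \<otimes> c) [^] p\<close>, because
  conjugation by \<open>g\<close> maps \<open>x\<close> to \<open>x \<otimes> c\<close>. Modulo \<open>H\<close> the element \<open>t\<close> is central, so the class
  two formula turns this into \<open>c [^] p \<otimes> t [^] (p choose 2)\<close>.
\<close>
lemma (in normal) commutator_pow_mem:
  fixes p :: nat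
  assumes p: "odd p" and x: "x \<in> carrier G" and g: "g \<in> carrier G"
    and c: "commutator x g [^] p \<in> H"
    and t: "commutator (commutator x g) x [^] p \<in> H"
    and central: "commutator (commutator x g) x \<in> central_mod H"
  shows "commutator (x [^] p) g \<in> H"
proof -
  define c where "c = commutator x g"
  define t where "t = commutator c x"
  have carr: "c \<in> carrier G" "t \<in> carrier G"
    using x g by (simp_all add: c_def t_def)
  define Q where "Q = G Mod H"
  define q where "q = (\<lambda>a. H #> a)"
  interpret Q: group_hom G Q q
    unfolding Q_def q_def by (rule group_hom_Mod)
  have q_one: "q a = \<one>\<^bsub>Q\<^esub> \<longleftrightarrow> a \<in> H" if "a \<in> carrier G" for a
    unfolding Q_def q_def using that by (rule r_coset_eq_one_iff)
  have commute: "q a \<otimes>\<^bsub>Q\<^esub> q t = q t \<otimes>\<^bsub>Q\<^esub> q a" if a: "a \<in> carrier G" for a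
  proof -
    have "q (commutator t a) = \<one>\<^bsub>Q\<^esub>"
      using central a carr by (subst q_one) (auto simp: t_def c_def central_mod_def)
    moreover have "t \<otimes> a = a \<otimes> t \<otimes> commutator t a"
      using a carr by (simp add: word_simps)
    ultimately show ?thesis
      using a carr by (metis Q.H.r_one Q.hom_closed Q.hom_mult inv_closed m_closed)
  qed
  have "c \<otimes> x = x \<otimes> c \<otimes> t"
    using carr x by (simp add: t_def word_simps)
  then have "q c \<otimes>\<^bsub>Q\<^esub> q x = q x \<otimes>\<^bsub>Q\<^esub> q c \<otimes>\<^bsub>Q\<^esub> q t"
    using carr x by (metis Q.hom_mult m_closed)
  then have "(q x \<otimes>\<^bsub>Q\<^esub> q c) [^]\<^bsub>Q\<^esub> p =
      q x [^]\<^bsub>Q\<^esub> p \<otimes>\<^bsub>Q\<^esub> q c [^]\<^bsub>Q\<^esub> p \<otimes>\<^bsub>Q\<^esub> q t [^]\<^bsub>Q\<^esub> (p choose 2)"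
    using carr x commute by (intro Q.H.pow_mult_class_two) auto
  moreover have "q c [^]\<^bsub>Q\<^esub> p = \<one>\<^bsub>Q\<^esub>"
    using c carr by (simp add: c_def q_one flip: Q.hom_nat_pow)
  moreover have "q t [^]\<^bsub>Q\<^esub> (p choose 2) = \<one>\<^bsub>Q\<^esub>"
  proof -
    \<comment> \<open>As \<open>p\<close> is odd, it divides the binomial coefficient.\<close>
    have "p choose 2 = p * ((p - 1) div 2)"
      using p by (auto simp: choose_two elim!: oddE)
    moreover have "q t [^]\<^bsub>Q\<^esub> p = \<one>\<^bsub>Q\<^esub>"
      using t carr by (simp add: t_def c_def q_one flip: Q.hom_nat_pow)
    ultimately show ?thesis
      using carr by (metis Q.H.nat_pow_one Q.H.nat_pow_pow Q.hom_closed)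
  qed
  ultimately have "q ((x \<otimes> c) [^] p) = q (x [^] p)"
    using carr x by (simp add: Q.hom_nat_pow)
  moreover have "(x \<otimes> c) [^] p = inv g \<otimes> x [^] p \<otimes> g"
    using x g by (simp add: c_def conj_pow) (simp add: word_simps)
  then have "commutator (x [^] p) g = inv (x [^] p) \<otimes> (x \<otimes> c) [^] p"
    using x g by (simp add: m_assoc)
  ultimately have "q (commutator (x [^] p) g) = \<one>\<^bsub>Q\<^esub>"
    using x carr by simp
  then show ?thesis using x g by (subst (asm) q_one) auto
qed

text \<open>
  Conjugacy classes of a group of order \<open>p ^ k\<close> have \<open>p\<close>-power size. If \<open>\<one>\<close> were the only
  central element of such a nontrivial group, all other classes would have size divisible by \<open>p\<close>, which contradicts the
  class equation. A suitable power of a nontrivial central element has order \<open>p\<close>.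
\<close>
lemma (in group) finite_p_group_central_element:
  fixes p :: nat
  assumes p: "prime p" and ord: "order G = p ^ k" and nontriv: "carrier G \<noteq> {\<one>}"
  shows "\<exists>z\<in>carrier G. z \<noteq> \<one> \<and> z [^] p = \<one> \<and> (\<forall>g\<in>carrier G. z \<otimes> g = g \<otimes> z)"
proof -
  have "p ^ k > 0" using p prime_gt_0_nat by simp
  then have fin: "finite (carrier G)"
    using ord by (metis order_gt_0_iff_finite)
  define \<phi> where "\<phi> = (\<lambda>g. \<lambda>h\<in>carrier G. g \<otimes> h \<otimes> inv g)"
  interpret A: group_action G "carrier G" \<phi>
    unfolding \<phi>_def by (rule action_by_conjugation)
  let ?O = "orbits G (carrier G) \<phi>"
  have finO: "finite ?O"
    using fin by (simp add: orbits_def)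
  have central_if: "z \<otimes> g = g \<otimes> z"
    if "orbit G \<phi> z = {z}" "z \<in> carrier G" "g \<in> carrier G" for z g
  proof -
    have "\<phi> g z = z" using that by (auto simp: orbit_def)
    then show ?thesis
      using that by (metis \<phi>_def inv_closed inv_solve_right m_closed restrict_apply')
  qed
  have "\<exists>z\<in>carrier G. z \<noteq> \<one> \<and> (\<forall>g\<in>carrier G. z \<otimes> g = g \<otimes> z)"
  proof (rule ccontr)
    assume no: "\<not> ?thesis"
    have one: "orbit G \<phi> \<one> = {\<one>}"
      by (auto simp: orbit_def \<phi>_def intro!: exI[of _ \<one>])
    have one_in: "{\<one>} \<in> ?O"
      using one by (auto simp: orbits_def)
    have "p dvd card orb" if orb: "orb \<in> ?O - {{\<one>}}" for orb
    proof -
      obtain x where x: "x \<in> carrier G" "orb = orbit G \<phi> x"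
        using orb by (auto simp: orbits_def)
      have "x \<noteq> \<one>" using orb x one by auto
      then have "orb \<noteq> {x}" using x no central_if by blast
      moreover have "x \<in> orb" using x A.orbit_refl by simp
      ultimately have "card orb \<noteq> 1" by (auto simp: card_1_singleton_iff)
      moreover have "card orb dvd p ^ k"
        using A.orbit_stabilizer_theorem[OF x(1)] ord x(2) by (metis dvd_triv_left)
      ultimately show ?thesis
        using p by (metis divides_primepow_nat dvd_power gr0I power_0)
    qed
    then have "p dvd (\<Sum>orb\<in>?O - {{\<one>}}. card orb)"
      by (rule dvd_sum)
    moreover have "order G = 1 + (\<Sum>orb\<in>?O - {{\<one>}}. card orb)"
    proof -
      have "order G = (\<Sum>x\<in>carrier G. 1)" by (simp add: order_def)
      also have "\<dots> = (\<Sum>orb\<in>?O. card orb)"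
        using A.disjoint_sum[OF fin, of "\<lambda>_. 1::nat"] by simp
      also have "\<dots> = card {\<one>} + (\<Sum>orb\<in>?O - {{\<one>}}. card orb)"
        using finO one_in by (rule sum.remove)
      finally show ?thesis by simp
    qed
    moreover have "k \<noteq> 0"
    proof
      assume "k = 0"
      then have "card (carrier G) = 1" using ord by (simp add: order_def)
      then obtain a where "carrier G = {a}" by (auto simp: card_1_singleton_iff)
      then show False using nontriv one_closed by simp
    qed
    then have "p dvd order G" using ord by simp
    ultimately have "p dvd 1" by (metis dvd_add_left_iff)
    then show False using p by simp
  qed
  then obtain z where z: "z \<in> carrier G" "z \<noteq> \<one>" "\<And>g. g \<in> carrier G \<Longrightarrow> z \<otimes> g = g \<otimes> z"
    by blast
  have "group.ord G z dvd p ^ k"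
    using ord_dvd_group_order[OF z(1)] ord by simp
  then obtain i where i: "group.ord G z = p ^ i"
    using p by (metis divides_primepow_nat)
  have "i \<noteq> 0" using i z by (metis ord_eq_1 power_0)
  then obtain j where j: "i = Suc j" by (cases i) auto
  define y where "y = z [^] (p ^ j)"
  have "\<not> p ^ i dvd p ^ j"
    using p j by (metis dvd_power_iff_le lessI not_le prime_ge_2_nat)
  then have "y \<noteq> \<one>"
    using pow_eq_id[OF z(1)] i by (simp add: y_def)
  moreover have "y [^] p = \<one>"
    using z(1) i j pow_eq_id[OF z(1), of "p ^ i"] by (simp add: y_def nat_pow_pow mult.commute)
  moreover have "y \<otimes> g = g \<otimes> y" if "g \<in> carrier G" for g
    unfolding y_def using z that by (intro group_commutes_pow) auto
  ultimately show ?thesis using z(1) by (auto simp: y_def)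
qed

text \<open>
  The subgroup \<open>K\<close> is the preimage of the central elements of \<open>G / H\<close> whose \<open>p\<close>-th power is
  trivial. This is the single step from which chains with central quotients of exponent \<open>p\<close> are
  built.
\<close>
lemma (in normal) central_extension_p_power_index:
  fixes p :: nat
  assumes p: "prime p" and ind: "card (rcosets H) = p ^ k" and proper: "H \<noteq> carrier G"
  obtains K where "K \<lhd> G" "H \<subset> K" "K \<subseteq> central_mod H" "\<And>x. x \<in> K \<Longrightarrow> x [^] p \<in> H"
proof -
  define Q where "Q = G Mod H"
  define q where "q = (\<lambda>a. H #> a)"
  interpret Q: group_hom G Q q
    unfolding Q_def q_def by (rule group_hom_Mod)
  have q_one: "q a = \<one>\<^bsub>Q\<^esub> \<longleftrightarrow> a \<in> H" if "a \<in> carrier G" for a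
    unfolding Q_def q_def using that by (rule r_coset_eq_one_iff)
  have carrQ: "carrier Q = q ` carrier G"
    by (simp add: Q_def q_def carrier_FactGroup)
  have commute: "q (commutator a g) = \<one>\<^bsub>Q\<^esub> \<longleftrightarrow> q a \<otimes>\<^bsub>Q\<^esub> q g = q g \<otimes>\<^bsub>Q\<^esub> q a"
    if a: "a \<in> carrier G" "g \<in> carrier G" for a g
  proof -
    have "a \<otimes> g = g \<otimes> a \<otimes> commutator a g"
      using a by (simp add: word_simps)
    then have "q a \<otimes>\<^bsub>Q\<^esub> q g = q g \<otimes>\<^bsub>Q\<^esub> q a \<otimes>\<^bsub>Q\<^esub> q (commutator a g)"
      using a by (metis Q.hom_mult inv_closed m_closed)
    then show ?thesis
      using a by (simp del: Q.hom_mult)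
  qed
  have mem_central: "a \<in> central_mod H \<longleftrightarrow> (\<forall>g\<in>carrier G. q a \<otimes>\<^bsub>Q\<^esub> q g = q g \<otimes>\<^bsub>Q\<^esub> q a)"
    if a: "a \<in> carrier G" for a
  proof -
    have "commutator a g \<in> H \<longleftrightarrow> q a \<otimes>\<^bsub>Q\<^esub> q g = q g \<otimes>\<^bsub>Q\<^esub> q a" if g: "g \<in> carrier G" for g
      using commute[OF a g] q_one[of "commutator a g"] a g by blast
    then show ?thesis using a by (simp add: central_mod_def)
  qed
  have norm: "H \<lhd> G" by (rule normal_axioms)
  define K where "K = {x \<in> central_mod H. x [^] p \<in> H}"
  have K_carr: "x \<in> carrier G" if "x \<in> K" for x
    using that by (simp add: K_def central_mod_def)
  have sub: "subgroup K G"
  proof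
    show "K \<subseteq> carrier G" using K_carr by blast
    show "\<one> \<in> K"
      using subgroup.one_closed[OF subgroup_central_mod[OF norm]] by (simp add: K_def)
    fix x y assume xy: "x \<in> K" "y \<in> K"
    have swap: "q x \<otimes>\<^bsub>Q\<^esub> q y = q y \<otimes>\<^bsub>Q\<^esub> q x"
      using mem_central[OF K_carr[OF xy(1)]] K_carr[OF xy(2)] xy(1) unfolding K_def by blast
    have "q ((x \<otimes> y) [^] p) = (q x \<otimes>\<^bsub>Q\<^esub> q y) [^]\<^bsub>Q\<^esub> p"
      using xy K_carr by (simp add: Q.hom_nat_pow)
    also have "\<dots> = q x [^]\<^bsub>Q\<^esub> p \<otimes>\<^bsub>Q\<^esub> q y [^]\<^bsub>Q\<^esub> p"
      using swap Q.hom_closed[OF K_carr[OF xy(1)]] Q.hom_closed[OF K_carr[OF xy(2)]]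
      by (rule Q.H.pow_mult_distrib)
    also have "\<dots> = \<one>\<^bsub>Q\<^esub>"
    proof -
      have "q (a [^] p) = \<one>\<^bsub>Q\<^esub>" if "a \<in> K" for a
        using that K_carr[OF that] q_one[of "a [^] p"] by (simp add: K_def)
      then show ?thesis using xy K_carr by (simp flip: Q.hom_nat_pow)
    qed
    finally have "(x \<otimes> y) [^] p \<in> H"
      using xy K_carr q_one by simp
    then show "x \<otimes> y \<in> K"
      using xy subgroup.m_closed[OF subgroup_central_mod[OF norm]] by (simp add: K_def)
  next
    fix x assume x: "x \<in> K"
    then show "inv x \<in> K"
      using subgroup.m_inv_closed[OF subgroup_central_mod[OF norm]] K_carr
      by (simp add: K_def nat_pow_inv)
  qed
  have HK: "H \<subseteq> K"
    using subset_central_mod_normal[OF norm] subgroup_nat_pow_closed[OF subgroup_axioms]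
    by (auto simp: K_def)
  have KZ: "K \<subseteq> central_mod H" by (auto simp: K_def)
  have "order Q = p ^ k"
    using ind by (simp add: Q_def order_def FactGroup_def)
  moreover have "carrier Q \<noteq> {\<one>\<^bsub>Q\<^esub>}"
  proof -
    obtain a where "a \<in> carrier G" "a \<notin> H" using proper subset by blast
    then have "q a \<in> carrier Q" "q a \<noteq> \<one>\<^bsub>Q\<^esub>"
      by (simp_all add: q_one)
    then show ?thesis by blast
  qed
  ultimately obtain z where z: "z \<in> carrier Q" "z \<noteq> \<one>\<^bsub>Q\<^esub>" "z [^]\<^bsub>Q\<^esub> p = \<one>\<^bsub>Q\<^esub>"
      "\<forall>g\<in>carrier Q. z \<otimes>\<^bsub>Q\<^esub> g = g \<otimes>\<^bsub>Q\<^esub> z"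
    using Q.H.finite_p_group_central_element[OF p] by metis
  then obtain x where x: "x \<in> carrier G" "z = q x" by (auto simp: carrQ)
  have "x \<in> K"
    using x z mem_central[of x] q_one[of "x [^] p"] by (auto simp: K_def Q.hom_nat_pow)
  moreover have "x \<notin> H" using x z q_one by simp
  ultimately have "H \<subset> K" using HK by blast
  moreover have "K \<lhd> G" by (rule normal_if_subset_central_mod[OF sub HK KZ])
  moreover have "x [^] p \<in> H" if "x \<in> K" for x using that by (simp add: K_def)
  ultimately show ?thesis using that KZ by blast
qed

context group
begin

lemma normal_set_mult:
  assumes X: "X \<lhd> G" and U: "U \<lhd> G"
  shows "X <#> U \<lhd> G"
proof (rule normal_invI)
  interpret X: normal X G by fact
  interpret U: normal U G by fact
  have mem: "a \<in> X <#> U \<longleftrightarrow> (\<exists>x\<in>X. \<exists>u\<in>U. a = x \<otimes> u)" for a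
    by (auto simp: set_mult_def)
  show "subgroup (X <#> U) G"
  proof
    show "X <#> U \<subseteq> carrier G" by (auto simp: mem)
    show "\<one> \<in> X <#> U" unfolding mem by (intro bexI[of _ "\<one>"]) simp_all
  next
    fix a b assume "a \<in> X <#> U" "b \<in> X <#> U"
    then obtain x u y v where *: "x \<in> X" "u \<in> U" "y \<in> X" "v \<in> U" "a = x \<otimes> u" "b = y \<otimes> v"
      by (auto simp: mem)
    have "a \<otimes> b = (x \<otimes> (u \<otimes> y \<otimes> inv u)) \<otimes> (u \<otimes> v)"
      using * X.mem_carrier U.mem_carrier by (simp add: word_simps)
    moreover have "x \<otimes> (u \<otimes> y \<otimes> inv u) \<in> X" "u \<otimes> v \<in> U"
      using * X.inv_op_closed2 U.mem_carrier by simp_all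
    ultimately show "a \<otimes> b \<in> X <#> U" using mem by blast
  next
    fix a assume "a \<in> X <#> U"
    then obtain x u where *: "x \<in> X" "u \<in> U" "a = x \<otimes> u"
      by (auto simp: mem)
    have "inv a = inv x \<otimes> (x \<otimes> inv u \<otimes> inv x)"
      using * X.mem_carrier U.mem_carrier by (simp add: word_simps)
    moreover have "inv x \<in> X" "x \<otimes> inv u \<otimes> inv x \<in> U"
      using * U.inv_op_closed2 X.mem_carrier by simp_all
    ultimately show "inv a \<in> X <#> U" using mem by blast
  qed
next
  interpret X: normal X G by fact
  interpret U: normal U G by fact
  fix g a assume g: "g \<in> carrier G" and "a \<in> X <#> U"
  then obtain x u where *: "x \<in> X" "u \<in> U" "a = x \<otimes> u"
    by (auto simp: set_mult_def)
  have "g \<otimes> a \<otimes> inv g = (g \<otimes> x \<otimes> inv g) \<otimes> (g \<otimes> u \<otimes> inv g)"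
    using * g X.mem_carrier U.mem_carrier by (simp add: word_simps)
  moreover have "g \<otimes> x \<otimes> inv g \<in> X" "g \<otimes> u \<otimes> inv g \<in> U"
    using * g X.inv_op_closed2 U.inv_op_closed2 by simp_all
  ultimately show "g \<otimes> a \<otimes> inv g \<in> X <#> U"
    unfolding set_mult_def by blast
qed

lemma subset_set_mult:
  assumes "subgroup X G" "subgroup U G"
  shows "X \<subseteq> X <#> U" "U \<subseteq> X <#> U"
proof -
  have "x = x \<otimes> \<one>" if "x \<in> X" for x using that subgroup.mem_carrier[OF assms(1)] by simp
  then show "X \<subseteq> X <#> U"
    unfolding set_mult_def using subgroup.one_closed[OF assms(2)] by blast
  have "x = \<one> \<otimes> x" if "x \<in> U" for x using that subgroup.mem_carrier[OF assms(2)] by simp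
  then show "U \<subseteq> X <#> U"
    unfolding set_mult_def using subgroup.one_closed[OF assms(1)] by blast
qed

lemma central_mod_mono: "X \<subseteq> Y \<Longrightarrow> central_mod X \<subseteq> central_mod Y"
  by (auto simp: central_mod_def)

lemma set_mult_subset_central_mod:
  assumes X: "X \<lhd> G" and U: "U \<lhd> G" and K: "K \<subseteq> central_mod U"
  shows "X <#> K \<subseteq> central_mod (X <#> U)"
proof
  have XU: "X <#> U \<lhd> G" by (rule normal_set_mult[OF X U])
  note sub = subset_set_mult[OF normal_imp_subgroup[OF X] normal_imp_subgroup[OF U]]
  fix a assume "a \<in> X <#> K"
  then obtain x k where a: "x \<in> X" "k \<in> K" "a = x \<otimes> k"
    by (auto simp: set_mult_def)
  have "x \<in> central_mod (X <#> U)"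
    using a(1) sub(1) subset_central_mod_normal[OF XU] by blast
  moreover have "k \<in> central_mod (X <#> U)"
    using a(2) K central_mod_mono[OF sub(2)] by blast
  ultimately show "a \<in> central_mod (X <#> U)"
    using subgroup.m_closed[OF subgroup_central_mod[OF XU]] a(3) by blast
qed

text \<open>
  The proof goes through a map of coset spaces because the ambient group may be infinite, where
  Lagrange's theorem says nothing about indices.
\<close>
lemma card_rcosets_less:
  assumes U: "subgroup U G" and K: "subgroup K G" and less: "U \<subset> K"
    and fin: "finite (rcosets U)"
  shows "card (rcosets K) < card (rcosets U)"
proof -
  define f where "f C = (\<Union>x\<in>C. K #> x)" for C
  have f: "f (U #> x) = K #> x" if x: "x \<in> carrier G" for x
  proof -
    have "K #> y = K #> x" if "y \<in> U #> x" for y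
    proof -
      have "y \<in> K #> x" using that less by (auto simp: r_coset_def)
      then show ?thesis using repr_independence[OF _ x K] by simp
    qed
    moreover have "x \<in> U #> x" using x U by (rule rcos_self)
    ultimately show ?thesis unfolding f_def by blast
  qed
  have img: "f ` (rcosets U) = rcosets K"
    unfolding RCOSETS_def using f by auto
  have "\<not> inj_on f (rcosets U)"
  proof
    assume inj: "inj_on f (rcosets U)"
    obtain k where k: "k \<in> K" "k \<notin> U" using less by blast
    have kc: "k \<in> carrier G" using k(1) K by (simp add: subgroup.mem_carrier)
    have "f (U #> k) = f (U #> \<one>)"
      using f kc k(1) K coset_join2[OF kc K k(1)] coset_join2[OF one_closed K subgroup.one_closed[OF K]]
      by simp
    then have "U #> k = U #> \<one>"
      using inj kc U by (auto simp: inj_on_def RCOSETS_def)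
    then have "k \<in> U #> \<one>" using rcos_self[OF kc U] by simp
    then show False using k(2) coset_join2[OF one_closed U subgroup.one_closed[OF U]] by simp
  qed
  moreover have "card (rcosets K) \<le> card (rcosets U)"
    using card_image_le[OF fin, of f] img by simp
  ultimately show ?thesis
    using eq_card_imp_inj_on[OF fin, of f] img by fastforce
qed

end

section \<open>Closed and open subgroups of topological groups\<close>

context topological_group
begin

lemma continuous_map_mult:
  assumes "continuous_map X T f" "continuous_map X T g"
  shows "continuous_map X T (\<lambda>x. f x \<otimes> g x)"
  using continuous_map_compose[OF continuous_map_pairedI[OF assms] continuous_mult]
  by (simp add: o_def)

lemma continuous_map_inv:
  assumes "continuous_map X T f"
  shows "continuous_map X T (\<lambda>x. inv (f x))"
  using continuous_map_compose[OF assms continuous_inv] by (simp add: o_def)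

lemma continuous_map_const_elem:
  assumes "a \<in> carrier G"
  shows "continuous_map X T (\<lambda>x. a)"
  using assms by (simp add: continuous_map_const topspace_eq)

lemmas continuous_word = continuous_map_mult continuous_map_inv continuous_map_const_elem
  continuous_map_id[unfolded id_def]

lemma closedin_preimage:
  assumes "continuous_map T T f" "closedin T X"
  shows "closedin T {z \<in> carrier G. f z \<in> X}"
  using closedin_continuous_map_preimage[OF assms] by (simp add: topspace_eq)

lemma openin_preimage:
  assumes "continuous_map T T f" "openin T X"
  shows "openin T {z \<in> carrier G. f z \<in> X}"
  using openin_continuous_map_preimage[OF assms] by (simp add: topspace_eq)

lemma subgroup_closure:
  assumes "subgroup H G"
  shows "subgroup (T closure_of H) G"
proof
  let ?C = "T closure_of H"
  have H: "H \<subseteq> topspace T"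
    using assms by (simp add: topspace_eq subgroup.subset)
  show "?C \<subseteq> carrier G"
    using closure_of_subset_topspace topspace_eq by metis
  show "\<one> \<in> ?C"
    using closure_of_subset[OF H] subgroup.one_closed[OF assms] by blast
  show "x \<otimes> y \<in> ?C" if "x \<in> ?C" "y \<in> ?C" for x y
  proof -
    have "(\<lambda>(x, y). x \<otimes> y) ` (prod_topology T T closure_of (H \<times> H))
        \<subseteq> T closure_of ((\<lambda>(x, y). x \<otimes> y) ` (H \<times> H))"
      by (rule continuous_map_image_closure_subset[OF continuous_mult])
    also have "\<dots> \<subseteq> ?C"
      by (rule closure_of_mono) (auto simp: subgroup.m_closed[OF assms])
    finally show ?thesis using that by (auto simp: closure_of_Times)
  qed
  show "inv x \<in> ?C" if "x \<in> ?C" for x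
  proof -
    have "(\<lambda>x. inv x) ` ?C \<subseteq> T closure_of ((\<lambda>x. inv x) ` H)"
      by (rule continuous_map_image_closure_subset[OF continuous_inv])
    also have "\<dots> \<subseteq> ?C"
      by (rule closure_of_mono) (auto simp: subgroup.m_inv_closed[OF assms])
    finally show ?thesis using that by blast
  qed
qed

text \<open>
  This is how the closed subgroups in the definitions are used: an inclusion into a closed subgroup
  only has to be checked on generators, without a description of the closure.
\<close>
lemma generate_closed_minimal:
  assumes "subgroup X G" "closedin T X" "S \<subseteq> X"
  shows "generate_closed G T S \<subseteq> X"
  unfolding generate_closed_def
  using generate_subgroup_incl[OF assms(3,1)] assms(2) by (rule closure_of_minimal)

lemma closedin_generate_closed: "closedin T (generate_closed G T S)"
  by (simp add: generate_closed_def)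

context
  fixes S assumes S: "S \<subseteq> carrier G"
begin

lemma subgroup_generate_closed: "subgroup (generate_closed G T S) G"
  unfolding generate_closed_def by (rule subgroup_closure[OF generate_is_subgroup[OF S]])

lemma generate_closed_incl: "S \<subseteq> generate_closed G T S"
proof -
  have "generate G S \<subseteq> T closure_of generate G S"
    using generate_incl[OF S] by (intro closure_of_subset) (simp add: topspace_eq)
  moreover have "S \<subseteq> generate G S"
    by (auto intro: generate.incl)
  ultimately show ?thesis
    unfolding generate_closed_def by simp
qed

lemma closed_normal_generate_closed:
  assumes conj: "\<And>g s. g \<in> carrier G \<Longrightarrow> s \<in> S \<Longrightarrow> g \<otimes> s \<otimes> inv g \<in> S"
  shows "closed_normal G T (generate_closed G T S)"
proof -
  let ?N = "generate_closed G T S"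
  interpret N: subgroup ?N G by (rule subgroup_generate_closed)
  have "?N \<subseteq> {z \<in> carrier G. g \<otimes> z \<otimes> inv g \<in> ?N}" if g: "g \<in> carrier G" for g
  proof (rule generate_closed_minimal)
    show "subgroup {z \<in> carrier G. g \<otimes> z \<otimes> inv g \<in> ?N} G"
    proof
      fix x y assume xy: "x \<in> {z \<in> carrier G. g \<otimes> z \<otimes> inv g \<in> ?N}"
        "y \<in> {z \<in> carrier G. g \<otimes> z \<otimes> inv g \<in> ?N}"
      then have "(g \<otimes> x \<otimes> inv g) \<otimes> (g \<otimes> y \<otimes> inv g) \<in> ?N" by simp
      then show "x \<otimes> y \<in> {z \<in> carrier G. g \<otimes> z \<otimes> inv g \<in> ?N}"
        using xy g by (simp add: word_simps)
    next
      fix x assume x: "x \<in> {z \<in> carrier G. g \<otimes> z \<otimes> inv g \<in> ?N}"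
      then have "inv (g \<otimes> x \<otimes> inv g) \<in> ?N" by simp
      then show "inv x \<in> {z \<in> carrier G. g \<otimes> z \<otimes> inv g \<in> ?N}"
        using x g by (simp add: word_simps)
    qed (use g in auto)
    show "closedin T {z \<in> carrier G. g \<otimes> z \<otimes> inv g \<in> ?N}"
      using g closedin_generate_closed
      by (intro closedin_preimage continuous_word) auto
    show "S \<subseteq> {z \<in> carrier G. g \<otimes> z \<otimes> inv g \<in> ?N}"
      using S conj[OF g] generate_closed_incl by blast
  qed
  then have "?N \<lhd> G"
    by (intro normal_invI subgroup_generate_closed) blast
  then show ?thesis
    by (simp add: closed_normal_def closedin_generate_closed)
qed

end

lemma closedin_central_mod:
  assumes "closedin T X"
  shows "closedin T (central_mod X)"
proof -
  have "central_mod X = (\<Inter>g\<in>carrier G. {z \<in> carrier G. commutator z g \<in> X})"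
    by (auto simp: central_mod_def)
  also have "closedin T \<dots>"
    using assms by (intro closedin_INT closedin_preimage continuous_word) auto
  finally show ?thesis .
qed

text \<open>
  Elements that are central modulo a closed normal subgroup form a closed subgroup, so
  \<open>[generate_closed G T S, G] \<le> X\<close> can be checked on the elements of \<open>S\<close>.
\<close>
lemma generate_closed_subset_central_mod:
  assumes "closed_normal G T X" "S \<subseteq> central_mod X"
  shows "generate_closed G T S \<subseteq> central_mod X"
  using assms by (intro generate_closed_minimal)
    (simp_all add: closed_normal_def subgroup_central_mod closedin_central_mod)

lemma closed_commutator_subset:
  assumes "closed_normal G T X" "N \<subseteq> central_mod X"
  shows "closed_commutator G T N (carrier G) \<subseteq> X"
  unfolding closed_commutator_def using assms
  by (intro generate_closed_minimal) (auto simp: closed_normal_def normal_def central_mod_def)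

lemma subgroup_openI:
  assumes H: "subgroup H G" and U: "subgroup U G" "openin T U" "U \<subseteq> H"
  shows "openin T H"
proof (subst openin_subopen, intro ballI exI conjI)
  fix h assume h: "h \<in> H"
  then have hc: "h \<in> carrier G" using H by (simp add: subgroup.mem_carrier)
  let ?W = "{x \<in> carrier G. inv h \<otimes> x \<in> U}"
  show "openin T ?W"
    using hc U(2) by (intro openin_preimage continuous_word) auto
  show "h \<in> ?W" using hc subgroup.one_closed[OF U(1)] by simp
  show "?W \<subseteq> H"
  proof
    fix x assume x: "x \<in> ?W"
    then have "h \<otimes> (inv h \<otimes> x) \<in> H" using U(3) h subgroup.m_closed[OF H] by blast
    then show "x \<in> H" using x hc by (simp add: word_simps)
  qed
qed

lemma open_subgroup_closed:
  assumes U: "subgroup U G" "openin T U"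
  shows "closedin T U"
proof -
  have "openin T (carrier G - U)"
  proof (subst openin_subopen, intro ballI exI conjI)
    fix y assume y: "y \<in> carrier G - U"
    let ?W = "{x \<in> carrier G. inv y \<otimes> x \<in> U}"
    show "openin T ?W"
      using y U(2) by (intro openin_preimage continuous_word) auto
    show "y \<in> ?W" using y subgroup.one_closed[OF U(1)] by simp
    show "?W \<subseteq> carrier G - U"
    proof
      fix x assume x: "x \<in> ?W"
      have "x \<notin> U"
      proof
        assume "x \<in> U"
        then have "x \<otimes> inv (inv y \<otimes> x) \<in> U"
          using x subgroup.m_closed[OF U(1)] subgroup.m_inv_closed[OF U(1)] by blast
        then show False using x y by (simp add: word_simps)
      qed
      then show "x \<in> carrier G - U" using x by blast
    qed
  qed
  then show ?thesis
    using subgroup.subset[OF U(1)] by (simp add: closedin_def topspace_eq)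
qed

lemma closed_normal_if_contains_open:
  assumes "X \<lhd> G" "U \<lhd> G" "openin T U" "U \<subseteq> X"
  shows "openin T X" "closed_normal G T X"
proof -
  show "openin T X"
    using assms by (intro subgroup_openI[of X U]) (auto simp: normal_imp_subgroup)
  then show "closed_normal G T X"
    using assms by (simp add: closed_normal_def open_subgroup_closed normal_imp_subgroup)
qed

end

section \<open>Approximation by open normal subgroups\<close>

context profinite_group
begin

text \<open>
  The normal core of an open subgroup \<open>H\<close> is open: the conjugate of \<open>H\<close> by \<open>g\<close> depends only on
  a coset of \<open>H\<close>, and by compactness finitely many cosets cover the group, so the core is a finite
  intersection.
\<close>
lemma open_normal_subgroup_base:
  assumes "openin T W" "\<one> \<in> W"
  obtains U where "U \<lhd> G" "openin T U" "U \<subseteq> W"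
proof -
  obtain H where H: "subgroup H G" "openin T H" "H \<subseteq> W"
    using open_subgroup_base[OF assms] by blast
  interpret H: subgroup H G by fact
  define U where "U = {x \<in> carrier G. \<forall>g\<in>carrier G. g \<otimes> x \<otimes> inv g \<in> H}"
  have sub: "subgroup U G"
  proof
    fix x y assume "x \<in> U" "y \<in> U"
    then have xy: "x \<in> carrier G" "y \<in> carrier G"
      "\<And>g. g \<in> carrier G \<Longrightarrow> (g \<otimes> x \<otimes> inv g) \<otimes> (g \<otimes> y \<otimes> inv g) \<in> H"
      by (simp_all add: U_def)
    then show "x \<otimes> y \<in> U" by (simp add: U_def word_simps)
  next
    fix x assume "x \<in> U"
    then have x: "x \<in> carrier G" "\<And>g. g \<in> carrier G \<Longrightarrow> inv (g \<otimes> x \<otimes> inv g) \<in> H"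
      by (simp_all add: U_def)
    then show "inv x \<in> U" by (simp add: U_def word_simps)
  qed (auto simp: U_def)
  have "U \<lhd> G"
  proof (rule normal_invI[OF sub])
    fix g x assume g: "g \<in> carrier G" and x: "x \<in> U"
    have "h \<otimes> (g \<otimes> x \<otimes> inv g) \<otimes> inv h \<in> H" if h: "h \<in> carrier G" for h
    proof -
      have "(h \<otimes> g) \<otimes> x \<otimes> inv (h \<otimes> g) \<in> H"
        using x g h unfolding U_def by blast
      then show ?thesis using x g h by (simp add: U_def word_simps)
    qed
    then show "g \<otimes> x \<otimes> inv g \<in> U" using g x by (simp add: U_def)
  qed
  moreover have "openin T U"
  proof -
    let ?C = "\<lambda>g. {x \<in> carrier G. x \<otimes> inv g \<in> H}"
    have "openin T (?C g)" if "g \<in> carrier G" for g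
      using that H(2) by (intro openin_preimage continuous_word) auto
    moreover have "\<Union> (?C ` carrier G) = topspace T"
      by (auto simp: topspace_eq)
    ultimately obtain \<F> where \<F>: "finite \<F>" "\<F> \<subseteq> ?C ` carrier G" "\<Union>\<F> = topspace T"
      using compact unfolding compact_space by (metis (no_types, lifting) imageE)
    from finite_subset_image[OF \<F>(1,2)] obtain F where F: "finite F" "F \<subseteq> carrier G" "\<F> = ?C ` F"
      by blast
    have F_cover: "\<Union> (?C ` F) = carrier G"
      using \<F>(3) F(3) topspace_eq by simp
    have "F \<noteq> {}" using F_cover one_closed by blast
    have "U = (\<Inter>f\<in>F. {x \<in> carrier G. f \<otimes> x \<otimes> inv f \<in> H})"
    proof
      show "U \<subseteq> (\<Inter>f\<in>F. {x \<in> carrier G. f \<otimes> x \<otimes> inv f \<in> H})"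
        using F(2) by (auto simp: U_def)
      show "(\<Inter>f\<in>F. {x \<in> carrier G. f \<otimes> x \<otimes> inv f \<in> H}) \<subseteq> U"
      proof
        fix x assume x: "x \<in> (\<Inter>f\<in>F. {x \<in> carrier G. f \<otimes> x \<otimes> inv f \<in> H})"
        then have xc: "x \<in> carrier G" using \<open>F \<noteq> {}\<close> by blast
        have "g \<otimes> x \<otimes> inv g \<in> H" if g: "g \<in> carrier G" for g
        proof -
          obtain f where f: "f \<in> F" "g \<otimes> inv f \<in> H" using F_cover g by blast
          have fc: "f \<in> carrier G" using f F by blast
          have "(g \<otimes> inv f) \<otimes> (f \<otimes> x \<otimes> inv f) \<otimes> inv (g \<otimes> inv f) \<in> H"
            using f x by blast
          then show ?thesis using xc g fc by (simp add: word_simps)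
        qed
        then show "x \<in> U" using xc by (simp add: U_def)
      qed
    qed
    also have "openin T \<dots>"
      using F(1,2) \<open>F \<noteq> {}\<close> H(2) by (intro openin_INT2 openin_preimage continuous_word) auto
    finally show ?thesis .
  qed
  moreover have "U \<subseteq> W"
  proof
    fix x assume "x \<in> U"
    then have "x \<in> carrier G" "\<one> \<otimes> x \<otimes> inv \<one> \<in> H" unfolding U_def by blast+
    then show "x \<in> W" using H(3) by auto
  qed
  ultimately show ?thesis using that by blast
qed

text \<open>
  A closed subgroup is determined by its images in the quotients by open normal subgroups. This
  reduces inclusions between closed subgroups to finite quotients while staying inside \<open>G\<close>.
\<close>
lemma mem_closed_subgroupI:
  assumes X: "subgroup X G" "closedin T X" and y: "y \<in> carrier G"
    and approx: "\<And>U. U \<lhd> G \<Longrightarrow> openin T U \<Longrightarrow> y \<in> X <#> U"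
  shows "y \<in> X"
proof (rule ccontr)
  assume "y \<notin> X"
  have "openin T (carrier G - X)"
    using X(2) by (simp add: closedin_def topspace_eq)
  then have "openin T {z \<in> carrier G. y \<otimes> z \<in> carrier G - X}"
    using y by (intro openin_preimage continuous_word) auto
  moreover have "\<one> \<in> {z \<in> carrier G. y \<otimes> z \<in> carrier G - X}"
    using y \<open>y \<notin> X\<close> by simp
  ultimately obtain U where U: "U \<lhd> G" "openin T U" "U \<subseteq> {z \<in> carrier G. y \<otimes> z \<in> carrier G - X}"
    by (rule open_normal_subgroup_base)
  obtain x u where xu: "x \<in> X" "u \<in> U" "y = x \<otimes> u"
    using approx[OF U(1,2)] by (auto simp: set_mult_def)
  have "inv u \<in> U"
    using xu(2) subgroup.m_inv_closed[OF normal_imp_subgroup[OF U(1)]] by blast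
  then have "y \<otimes> inv u \<notin> X" using U(3) by blast
  moreover have "y \<otimes> inv u = x"
    using xu subgroup.mem_carrier[OF X(1)] subgroup.mem_carrier[OF normal_imp_subgroup[OF U(1)]]
    by (simp add: word_simps)
  ultimately show False using xu(1) by simp
qed

end

text \<open>
  A finite \<open>p\<close>-group has a normal series whose quotients are central of exponent \<open>p\<close>. The rule
  uses such a series of \<open>G / U\<close>, descending from \<open>G\<close> to \<open>U\<close>, in the form of an induction on the
  index of \<open>U\<close>.
\<close>
lemma (in pro_p_group) open_normal_induct [consumes 3, case_names whole step]:
  assumes p: "prime p" and U: "U \<lhd> G" "openin T U"
    and whole: "P (carrier G)"
    and step: "\<And>U K. \<lbrakk>U \<lhd> G; openin T U; K \<lhd> G; openin T K; U \<subseteq> K; K \<subseteq> central_mod U;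
      \<And>x. x \<in> K \<Longrightarrow> x [^] p \<in> U; P K\<rbrakk> \<Longrightarrow> P U"
  shows "P U"
  using U
proof (induction "card (rcosets U)" arbitrary: U rule: less_induct)
  case less
  show ?case
  proof (cases "U = carrier G")
    case False
    obtain k where k: "card (rcosets U) = p ^ k"
      using index_power[OF less.prems] by blast
    obtain K where K: "K \<lhd> G" "U \<subset> K" "K \<subseteq> central_mod U" "\<And>x. x \<in> K \<Longrightarrow> x [^] p \<in> U"
      using normal.central_extension_p_power_index[OF less.prems(1) p k False] by metis
    have "openin T K"
      using closed_normal_if_contains_open(1)[OF K(1) less.prems] K(2) by blast
    moreover have "card (rcosets K) < card (rcosets U)"
    proof (rule card_rcosets_less)
      have "card (rcosets U) > 0" using k p by (simp add: prime_gt_0_nat)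
      then show "finite (rcosets U)" using card_gt_0_iff by blast
    qed (use less.prems K normal_imp_subgroup in blast)+
    ultimately have "P K" using less.hyps K(1) by blast
    then show ?thesis
      using step[OF less.prems K(1) \<open>openin T K\<close>] K by blast
  qed (use whole in simp)
qed

section \<open>The potent filtration attached to an \<open>\<eta>\<close>-series\<close>

text \<open>
  Powerful embedding of \<open>M N / N\<close> in \<open>G / N\<close>, stated inside \<open>G\<close>: any closed normal subgroup \<open>X\<close>
  that contains \<open>N\<close> and the \<open>p\<close>-th powers of \<open>M\<close> contains \<open>[M, G]\<close>. The reason is that the
  image of \<open>X\<close> in the quotient is a closed subgroup containing all \<open>p\<close>-th powers of the image of
  \<open>M\<close>.
\<close>
lemma (in topological_group) powerfully_embedded_quotient_central_mod:
  fixes p :: nat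
  assumes N: "N \<lhd> G" and M: "M \<subseteq> carrier G"
    and pe: "powerfully_embedded p (G Mod N) (Mod_topology G T N) ((\<lambda>x. N #> x) ` M)"
    and X: "closed_normal G T X" "N \<subseteq> X" and pow: "\<And>x. x \<in> M \<Longrightarrow> x [^] p \<in> X"
  shows "M \<subseteq> central_mod X"
proof -
  define Q where "Q = G Mod N"
  define q where "q = (\<lambda>a. N #> a)"
  define TQ where "TQ = Mod_topology G T N"
  interpret N: normal N G by (rule N)
  interpret Q: group_hom G Q q
    unfolding Q_def q_def by (rule N.group_hom_Mod)
  have q_one: "q a = \<one>\<^bsub>Q\<^esub> \<longleftrightarrow> a \<in> N" if "a \<in> carrier G" for a
    unfolding Q_def q_def using that by (rule N.r_coset_eq_one_iff)
  have carrQ: "carrier Q = q ` carrier G"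
    by (simp add: Q_def q_def carrier_FactGroup)
  have qmap: "quotient_map T TQ q"
    unfolding TQ_def Mod_topology_def q_def by (rule quotient_map_quotient_topology)
  have topQ: "topspace TQ = carrier Q"
    using qmap by (auto simp: quotient_map_def topspace_eq carrQ)
  have Xsub: "subgroup X G" "closedin T X"
    using X(1) by (simp_all add: closed_normal_def normal_imp_subgroup)
  have Xcarr: "X \<subseteq> carrier G" by (rule subgroup.subset[OF Xsub(1)])
  \<comment> \<open>Since \<open>N \<subseteq> X\<close>, the subgroup \<open>X\<close> is a union of cosets of \<open>N\<close>.\<close>
  have mem_X: "a \<in> X" if a: "a \<in> carrier G" "q a \<in> q ` X" for a
  proof -
    obtain x where x: "x \<in> X" "q a = q x" using a(2) by blast
    have xc: "x \<in> carrier G" using x(1) Xcarr by blast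
    have "q (a \<otimes> inv x) = \<one>\<^bsub>Q\<^esub>" using x a xc by simp
    then have "a \<otimes> inv x \<in> X" using q_one[of "a \<otimes> inv x"] a xc X(2) by auto
    then have "a \<otimes> inv x \<otimes> x \<in> X" using x(1) by (rule subgroup.m_closed[OF Xsub(1)])
    then show ?thesis using a xc by (simp add: m_assoc)
  qed
  have closedX: "closedin TQ (q ` X)"
  proof -
    have "{x \<in> topspace T. q x \<in> q ` X} = X"
      using mem_X Xcarr by (auto simp: topspace_eq)
    moreover have "q ` X \<subseteq> topspace TQ" using Xcarr by (auto simp: topQ)
    ultimately show ?thesis
      using qmap Xsub(2) unfolding quotient_map_closedin by metis
  qed
  let ?P = "{x [^]\<^bsub>Q\<^esub> p |x. x \<in> q ` M}"
  have "?P \<subseteq> q ` X"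
  proof
    fix a assume "a \<in> ?P"
    then obtain m where m: "m \<in> M" "a = q m [^]\<^bsub>Q\<^esub> p" by blast
    then have "a = q (m [^] p)" using M by (simp add: Q.hom_nat_pow subsetD)
    then show "a \<in> q ` X" using pow m(1) by blast
  qed
  then have "generate Q ?P \<subseteq> q ` X"
    by (rule Q.H.generate_subgroup_incl) (rule Q.subgroup_img_is_subgroup[OF Xsub(1)])
  then have powers: "closed_powers p Q TQ (q ` M) \<subseteq> q ` X"
    unfolding closed_powers_def generate_closed_def using closedX by (rule closure_of_minimal)
  let ?C = "{inv\<^bsub>Q\<^esub> h \<otimes>\<^bsub>Q\<^esub> inv\<^bsub>Q\<^esub> k \<otimes>\<^bsub>Q\<^esub> h \<otimes>\<^bsub>Q\<^esub> k |h k. h \<in> q ` M \<and> k \<in> carrier Q}"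
  have "?C \<subseteq> carrier Q" using M by auto
  then have "generate Q ?C \<subseteq> topspace TQ"
    unfolding topQ by (rule Q.H.generate_incl)
  then have "generate Q ?C \<subseteq> closed_commutator Q TQ (q ` M) (carrier Q)"
    unfolding closed_commutator_def generate_closed_def by (rule closure_of_subset)
  moreover have "closed_commutator Q TQ (q ` M) (carrier Q) \<subseteq> closed_powers p Q TQ (q ` M)"
    using pe by (simp add: powerfully_embedded_def Q_def TQ_def q_def)
  ultimately have comm: "generate Q ?C \<subseteq> q ` X" using powers by blast
  show ?thesis
  proof
    fix m assume m: "m \<in> M"
    then have mc: "m \<in> carrier G" using M by blast
    have "commutator m g \<in> X" if g: "g \<in> carrier G" for g
    proof (rule mem_X)
      have "inv\<^bsub>Q\<^esub> q m \<otimes>\<^bsub>Q\<^esub> inv\<^bsub>Q\<^esub> q g \<otimes>\<^bsub>Q\<^esub> q m \<otimes>\<^bsub>Q\<^esub> q g \<in> ?C"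
        using m Q.hom_closed[OF g] by blast
      then have "inv\<^bsub>Q\<^esub> q m \<otimes>\<^bsub>Q\<^esub> inv\<^bsub>Q\<^esub> q g \<otimes>\<^bsub>Q\<^esub> q m \<otimes>\<^bsub>Q\<^esub> q g \<in> q ` X"
        using comm generate.incl by (metis (no_types, lifting) subsetD)
      then show "q (commutator m g) \<in> q ` X"
        using mc g by simp
    qed (use mc g in simp)
    then show "m \<in> central_mod X" using mc by (simp add: central_mod_def)
  qed
qed

locale pro_p_group_eta_series = pro_p_group +
  fixes N :: "nat \<Rightarrow> 'a set" and k :: nat
  assumes p_prime: "prime p" and p_odd: "odd p"
    and eta: "eta_series p G T N" and top: "N k = carrier G"
begin

lemma N_zero: "N 0 = {\<one>}"
  and N_closed_normal: "closed_normal G T (N i)"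
  and N_Suc: "N i \<subseteq> N (Suc i)"
  using eta by (simp_all add: eta_series_def)

lemma N_carrier: "N i \<subseteq> carrier G"
  using N_closed_normal[of i] normal_imp_subgroup subgroup.subset
  unfolding closed_normal_def by blast

text \<open>
  Each step down replaces \<open>L n\<close> by its \<open>p\<close>-th powers, and as long as \<open>Suc n < k\<close> adds the next
  lower term of the \<open>\<eta>\<close>-series. For \<open>Suc n \<ge> k\<close> the truncated subtraction gives \<open>N 0 = {\<one>}\<close>, so that
  only the powers remain.
\<close>
primrec L :: "nat \<Rightarrow> 'a set" where
  "L 0 = carrier G"
| "L (Suc n) = generate_closed G T ({x [^] p |x. x \<in> L n} \<union> N (k - Suc n))"

declare L.simps(2) [simp del]

lemma p_ge_3: "p \<ge> 3"
  using p_prime p_odd prime_ge_2_nat[of p] by (cases "p = 2") auto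

lemma closed_normal_carrier: "closed_normal G T (carrier G)"
  unfolding closed_normal_def
  using normal_invI[OF subgroup_self] topspace_eq closedin_topspace[of T] by simp

lemma closed_normal_L: "closed_normal G T (L n)"
proof (induction n)
  case (Suc n)
  interpret Mn: normal "L n" G using Suc by (simp add: closed_normal_def)
  interpret Nn: normal "N (k - Suc n)" G using N_closed_normal by (simp add: closed_normal_def)
  have "g \<otimes> x [^] p \<otimes> inv g = (g \<otimes> x \<otimes> inv g) [^] p" if "g \<in> carrier G" "x \<in> L n" for g x
    using conj_pow[of x "inv g" p] that by simp
  moreover have "g \<otimes> x \<otimes> inv g \<in> L n" if "g \<in> carrier G" "x \<in> L n" for g x
    using that by (rule Mn.inv_op_closed2)
  ultimately have "\<exists>y. g \<otimes> x [^] p \<otimes> inv g = y [^] p \<and> y \<in> L n"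
    if "g \<in> carrier G" "x \<in> L n" for g x
    using that by blast
  then show ?case
    unfolding L.simps
    by (intro closed_normal_generate_closed) (auto simp: Nn.inv_op_closed2)
qed (simp add: closed_normal_carrier)

lemma L_normal: "L n \<lhd> G" and L_closed: "closedin T (L n)"
  using closed_normal_L by (simp_all add: closed_normal_def)

lemma L_subgroup: "subgroup (L n) G"
  using L_normal by (rule normal_imp_subgroup)

lemma L_carrier: "L n \<subseteq> carrier G"
  using L_subgroup by (rule subgroup.subset)

lemma L_Suc_generators: "{x [^] p |x. x \<in> L n} \<union> N (k - Suc n) \<subseteq> L (Suc n)"
  unfolding L.simps using L_carrier[of n] N_carrier by (intro generate_closed_incl) auto

lemma pow_mem_L: "x \<in> L n \<Longrightarrow> x [^] p \<in> L (Suc n)"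
  using L_Suc_generators by blast

lemma N_subset_L: "N (k - n) \<subseteq> L n"
  using L_Suc_generators top by (cases n) auto

lemma L_Suc_subset: "L (Suc n) \<subseteq> L n"
  unfolding L.simps(2)
proof (rule generate_closed_minimal[OF L_subgroup L_closed])
  have "N (k - Suc n) \<subseteq> N (k - n)"
    by (rule lift_Suc_mono_le[of N, OF N_Suc]) simp
  then have "N (k - Suc n) \<subseteq> L n"
    using N_subset_L[of n] by (rule order_trans)
  moreover have "{x [^] p |x. x \<in> L n} \<subseteq> L n"
    using subgroup_nat_pow_closed[OF L_subgroup] by auto
  ultimately show "{x [^] p |x. x \<in> L n} \<union> N (k - Suc n) \<subseteq> L n"
    by (intro Un_least)
qed

lemma L_antimono: "m \<le> n \<Longrightarrow> L n \<subseteq> L m"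
  using L_Suc_subset by (rule lift_Suc_antimono_le)

lemma N_central_mod: "N (k - n) \<subseteq> central_mod (L (Suc n))"
proof (cases "k - n")
  case 0
  then show ?thesis
    using N_zero subgroup.one_closed[OF L_subgroup[of "Suc n"]] by (simp add: central_mod_def)
next
  case (Suc i)
  then have i: "k - Suc n = i" by simp
  have "N (Suc i) \<subseteq> central_mod (L (Suc n))"
  proof (rule powerfully_embedded_quotient_central_mod)
    show "N i \<lhd> G" using N_closed_normal by (simp add: closed_normal_def)
    show "powerfully_embedded p (G Mod N i) (Mod_topology G T (N i)) ((\<lambda>x. N i #> x) ` N (Suc i))"
      using eta by (simp add: eta_series_def)
    show "N i \<subseteq> L (Suc n)" using N_subset_L[of "Suc n"] i by simp
    show "x [^] p \<in> L (Suc n)" if "x \<in> N (Suc i)" for x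
      using pow_mem_L N_subset_L[of n] that Suc by auto
  qed (rule N_carrier closed_normal_L)+
  then show ?thesis using Suc by simp
qed

lemma commutator_mem_L:
  assumes "x \<in> central_mod (L n)" "g \<in> carrier G"
  shows "commutator x g \<in> L n"
  using assms by (simp add: central_mod_def)

text \<open>
  This is \<open>[L n, G] \<le> L (Suc n)\<close>, the heart of the proof. For \<open>L 0 = N k\<close> and for
  the generators of \<open>L (Suc n)\<close> in \<open>N (k - Suc n)\<close> it comes from the \<open>\<eta>\<close>-series. For a generator
  \<open>x [^] p\<close> with \<open>x \<in> L n\<close>, put \<open>X = L (Suc (Suc n))\<close>, \<open>c = [x, g]\<close> and \<open>t = [c, x]\<close>. By
  induction \<open>c\<close>, hence also \<open>t\<close>, lies in \<open>L (Suc n)\<close>, and therefore their \<open>p\<close>-th powers lie in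
  \<open>X\<close>. To apply the class two formula,
  \<open>t\<close> must be central, and this is arranged by working modulo \<open>X U\<close> for an open normal
  subgroup \<open>U\<close>, by induction on the index of \<open>U\<close>: if \<open>[K, G] \<le> U\<close> and
  \<open>[L (Suc n), G] \<le> X K\<close> is already known, then \<open>t \<in> X K\<close> is central modulo \<open>X U\<close>.
\<close>
lemma L_central_mod: "L n \<subseteq> central_mod (L (Suc n))"
proof (induction n)
  case 0
  show ?case using N_central_mod[of 0] top by simp
next
  case (Suc n)
  let ?X = "L (Suc (Suc n))"
  have approx: "L (Suc n) \<subseteq> central_mod (?X <#> U)" if U: "U \<lhd> G" "openin T U" for U
    using p_prime U
  proof (induction rule: open_normal_induct)
    case whole
    have "carrier G \<subseteq> ?X <#> carrier G"
      using subset_set_mult(2)[OF L_subgroup subgroup_self] .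
    then show ?case
      using L_carrier[of "Suc n"] by (auto simp: central_mod_def subset_iff)
  next
    case (step U K)
    let ?XU = "?X <#> U"
    have XU: "?XU \<lhd> G" using L_normal step(1) by (rule normal_set_mult)
    note sub = subset_set_mult[OF L_subgroup[of "Suc (Suc n)"] normal_imp_subgroup[OF step(1)]]
    have XUc: "closed_normal G T ?XU"
      using closed_normal_if_contains_open(2)[OF XU step(1,2) sub(2)] .
    have XK: "?X <#> K \<subseteq> central_mod ?XU"
      using L_normal step(1,6) by (rule set_mult_subset_central_mod)
    have "x [^] p \<in> central_mod ?XU" if x: "x \<in> L n" for x
    proof -
      have xc: "x \<in> carrier G" using x L_carrier by blast
      have "commutator (x [^] p) g \<in> ?XU" if g: "g \<in> carrier G" for g
      proof (rule normal.commutator_pow_mem[OF XU p_odd xc g])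
        let ?c = "commutator x g"
        have c: "?c \<in> L (Suc n)"
          using subsetD[OF Suc.IH x] g by (rule commutator_mem_L)
        have t: "commutator ?c x \<in> L (Suc n)"
          using subsetD[OF subset_central_mod_normal[OF L_normal] c] xc by (rule commutator_mem_L)
        show "?c [^] p \<in> ?XU" using pow_mem_L[OF c] sub(1) by blast
        show "commutator ?c x [^] p \<in> ?XU" using pow_mem_L[OF t] sub(1) by blast
        have "?c \<in> central_mod (?X <#> K)" using step(8) c by blast
        then have "commutator ?c x \<in> ?X <#> K" using xc unfolding central_mod_def by blast
        then show "commutator ?c x \<in> central_mod ?XU" using XK by blast
      qed
      then show ?thesis using xc by (simp add: central_mod_def)
    qed
    moreover have "N (k - Suc n) \<subseteq> central_mod ?XU"
      using N_central_mod[of "Suc n"] central_mod_mono[OF sub(1)] by blast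
    ultimately show ?case
      unfolding L.simps(2)[of n] using XUc
      by (intro generate_closed_subset_central_mod) auto
  qed
  show ?case
  proof
    fix z assume z: "z \<in> L (Suc n)"
    then have zc: "z \<in> carrier G" using L_carrier by blast
    have "commutator z g \<in> ?X" if g: "g \<in> carrier G" for g
    proof (rule mem_closed_subgroupI[OF L_subgroup L_closed])
      show "commutator z g \<in> ?X <#> U" if "U \<lhd> G" "openin T U" for U
        using approx[OF that] z g unfolding central_mod_def by blast
    qed (use zc g in simp)
    then show "z \<in> central_mod ?X" using zc unfolding central_mod_def by blast
  qed
qed

text \<open>
  Once \<open>L n \<subseteq> K\<close>, it takes \<open>k\<close> further steps to get past the \<open>\<eta>\<close>-series. After that the next
  term is generated by \<open>p\<close>-th powers of elements of \<open>K\<close>, which lie in \<open>U\<close>.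
\<close>
lemma L_subset_open:
  assumes "U \<lhd> G" "openin T U"
  shows "\<exists>n. L n \<subseteq> U"
  using p_prime assms
proof (induction rule: open_normal_induct)
  case whole
  show ?case using L_carrier by blast
next
  case (step U K)
  then obtain n where n: "L n \<subseteq> K" by blast
  have "L (Suc (n + k)) \<subseteq> U"
    unfolding L.simps
  proof (rule generate_closed_minimal)
    show "subgroup U G" by (rule normal_imp_subgroup[OF step(1)])
    then show "closedin T U" using step(2) by (rule open_subgroup_closed)
    have "x [^] p \<in> U" if "x \<in> L (n + k)" for x
      using that n L_antimono[of n "n + k"] step(7) by auto
    moreover have "N (k - Suc (n + k)) \<subseteq> U"
      using N_zero subgroup.one_closed[OF \<open>subgroup U G\<close>] by simp
    ultimately show "{x [^] p |x. x \<in> L (n + k)} \<union> N (k - Suc (n + k)) \<subseteq> U"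
      by blast
  qed
  then show ?case by blast
qed

lemma INT_L: "(\<Inter>n. L n) = {\<one>}"
proof
  show "{\<one>} \<subseteq> (\<Inter>n. L n)"
    using subgroup.one_closed[OF L_subgroup] by blast
  show "(\<Inter>n. L n) \<subseteq> {\<one>}"
  proof
    fix y assume y: "y \<in> (\<Inter>n. L n)"
    have "y \<in> N 0"
    proof (rule mem_closed_subgroupI)
      show N0: "subgroup (N 0) G" "closedin T (N 0)"
        using N_closed_normal[of 0] by (simp_all add: closed_normal_def normal_imp_subgroup)
      show "y \<in> carrier G" using y L_carrier by blast
      show "y \<in> N 0 <#> U" if "U \<lhd> G" "openin T U" for U
        using L_subset_open[OF that] y
          subset_set_mult(2)[OF N0(1) normal_imp_subgroup[OF that(1)]] by blast
    qed
    then show "y \<in> {\<one>}" using N_zero by simp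
  qed
qed

lemma iterated_commutator_subset_L: "iterated_commutator G T j (L n) \<subseteq> L (n + j)"
proof (induction j)
  case (Suc j)
  have "closed_commutator G T (iterated_commutator G T j (L n)) (carrier G) \<subseteq> L (Suc (n + j))"
    using Suc L_central_mod[of "n + j"] by (intro closed_commutator_subset closed_normal_L) blast
  then show ?case by (simp add: iterated_commutator_def)
qed (simp add: iterated_commutator_def)

text \<open>
  The hypothesis \<open>k \<le> Suc n\<close> says that the \<open>\<eta>\<close>-series is exhausted, so that \<open>L (Suc n)\<close> is
  generated by the \<open>p\<close>-th powers of \<open>L n \<subseteq> L m\<close>.
\<close>
lemma L_subset_closed_powers:
  assumes "m \<le> n" "k \<le> Suc n"
  shows "L (Suc n) \<subseteq> closed_powers p G T (L m)"
  unfolding L.simps closed_powers_def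
proof (rule generate_closed_minimal)
  have carr: "{x [^] p |x. x \<in> L m} \<subseteq> carrier G" using L_carrier by auto
  then show sub: "subgroup (generate_closed G T {x [^] p |x. x \<in> L m}) G"
    by (rule subgroup_generate_closed)
  have "{x [^] p |x. x \<in> L n} \<subseteq> {x [^] p |x. x \<in> L m}"
    using L_antimono[OF assms(1)] by blast
  moreover have "N (k - Suc n) = {\<one>}" using assms(2) N_zero by simp
  ultimately show "{x [^] p |x. x \<in> L n} \<union> N (k - Suc n)
      \<subseteq> generate_closed G T {x [^] p |x. x \<in> L m}"
    using generate_closed_incl[OF carr] subgroup.one_closed[OF sub] by auto
qed (rule closedin_generate_closed)

text \<open>
  Here the bound on the class enters: \<open>[L n, G, \<dots>, G]\<close> with \<open>p - 1\<close> copies of \<open>G\<close> lies in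
  \<open>L (n + (p - 1))\<close>, whose index is at least \<open>k\<close>, so that this term is generated by \<open>p\<close>-th
  powers of \<open>L (n + p - 2)\<close>. As \<open>p \<ge> 3\<close>, the latter is contained in \<open>L (Suc n)\<close>.
\<close>
lemma potent_filtration_L:
  assumes k: "k < p"
  shows "potent_filtration p G T (carrier G) (\<lambda>i. L (i - 1))"
proof -
  have "(\<Inter>i\<in>{1..}. L (i - 1)) = (\<Inter>n. L n)"
  proof -
    have "(\<lambda>i. L (i - 1)) ` {1..} = range L"
      by (force simp: image_iff intro: bexI[of _ "Suc _"])
    then show ?thesis by simp
  qed
  then have inter: "(\<Inter>i\<in>{1..}. L (i - 1)) = {\<one>}" using INT_L by simp
  have powers: "iterated_commutator G T (p - 1) (L n) \<subseteq> closed_powers p G T (L (Suc n))" for n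
  proof -
    have "n + (p - 1) = Suc (n + p - 2)" "Suc n \<le> n + p - 2" "k \<le> Suc (n + p - 2)"
      using k p_ge_3 by simp_all
    then show ?thesis
      using iterated_commutator_subset_L[of "p - 1" n] L_subset_closed_powers[of "Suc n" "n + p - 2"]
      by auto
  qed
  have comms: "closed_commutator G T (L n) (carrier G) \<subseteq> L (Suc n)" for n
    by (intro closed_commutator_subset closed_normal_L L_central_mod)
  have "L (Suc i - 1) \<subseteq> L (i - 1) \<and> closed_commutator G T (L (i - 1)) (carrier G) \<subseteq> L (Suc i - 1)
      \<and> iterated_commutator G T (p - 1) (L (i - 1)) \<subseteq> closed_powers p G T (L (Suc i - 1))"
    if i: "1 \<le> i" for i
  proof -
    obtain n where "i = Suc n" using i by (cases i) auto
    then show ?thesis using L_Suc_subset[of n] comms[of n] powers[of n] by simp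
  qed
  then show ?thesis
    unfolding potent_filtration_def using inter closed_normal_L by simp
qed

end

theorem corollary3p3:
  fixes p :: nat and G :: "('a, 'b) monoid_scheme" and T :: "'a topology"
  assumes "prime p" and "odd p"
    and "pro_p_group p G T"
    and "topologically_finitely_generated G T"
    and "small_powerful_class p G T"
  shows "PF_group p G T"
proof -
  have "powerful_class p G T < enat p"
    using assms(5) by (simp add: small_powerful_class_def)
  then obtain k N where k: "k < p" and N: "eta_series p G T N" "N k = carrier G"
    unfolding powerful_class_def Inf_less_iff by auto
  interpret pro_p_group_eta_series p G T N k
    using assms(1-3) N
    by (simp add: pro_p_group_eta_series_def pro_p_group_eta_series_axioms_def)
  show ?thesis
    unfolding PF_group_def PF_embedded_def
    using closed_normal_carrier potent_filtration_L[OF k] by blast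
qed

end
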